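(* Let $\mathbb{K}$ be a field of characteristic zero, $G$ an abelian group, and $\chi:G\times G\to\mathbb{K}^\times$ a skew-symmetric bicharacter. Let $(M,[x,y]_\chi)$ be a Malcev color-algebra. Let also $A$ be a color-algebra and $f:M\to N_{color}(A)^-$ a morphism of Malcev color-algebras. Then there exists a unique algebra morphism $U(f):U(M)\to A$ such that $U(f)\circ i=f$, where $i:M\to U(M)$ is the map $i(x)=x+I$.
   Context: Skew-symmetric bicharacter: $\chi(ab,c)=\chi(a,c)\chi(b,c)$, $\chi(a,bc)=\chi(a,b)\chi(a,c)$, $\chi(a,b)\chi(b,a)=1$. For homogeneous elements, $\chi(v,w)$ means $\chi(|v|,|w|)$, where $|v|$ is the degree of $v$. A color-algebra (called simply an algebra) is a $G$-graded vector space $A=\bigoplus_{g\in G} A_g$ with a bilinear (not necessarily associative) product satisfying $A_gA_h\subseteq A_{gh}$; morphisms are linear, multiplicative and preserve degree. The associator is $(a,b,c)=(ab)c-a(bc)$. Malcev color-algebra: a color-algebra with product $[\,,]_\chi$ such that, for homogeneous elements, $[a,b]_\chi=-\chi(a,b)[b,a]_\chi$ and $\chi(y,z)[[x,z],[y,w]]=[[[x,y],z],w]+\chi(x,y)\chi(x,z)\chi(x,w)[[[y,z],w],x]+\chi(y,z)\chi(x,z)\chi(y,w)\chi(x,w)[[[z,w],x],y]+\chi(z,w)\chi(y,w)\chi(x,w)[[[w,x],y],z]$ (all brackets being $[\,,]_\chi$). The color-alternative nucleus of $A$ is $N_{color}(A)=\bigoplus_{g\in G}\{x\in A_g: (x,y,z)=-\chi(x,y)(y,x,z)\text{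 and }(y,z,x)=-\chi(z,x)(y,x,z)\text{ for all homogeneous }y,z\in A\}$. $N_{color}(A)^-$ is this space with the bracket $[a,b]_\chi=ab-\chi(a,b)ba$ (homogeneous $a,b$), which makes it a Malcev color-algebra. $U(M)=\mathbb{K}\{M\}/I$, where $\mathbb{K}\{M\}$ is the free (nonassociative) algebra generated by the graded space $M$, and $I$ is the ideal generated by $xy-\chi(x,y)yx-[x,y]_\chi$, $(x,a,b)+\chi(x,a)(a,x,b)$, $(a,x,b)+\chi(x,b)(a,b,x)$ for homogeneous $x,y\in M$ and homogeneous $a,b\in\mathbb{K}\{M\}$ (juxtaposition denotes the product of $\mathbb{K}\{M\}$). *)

theory Defs
  imports "HOL-Algebra.QuotRing" "HOL-Algebra.Module"
begin

text \<open>
  All structures are carrier-based records in the style of HOL-Algebra.  A graded algebra is a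
  \<open>module\<close> record whose \<open>mult\<close> field is the (nonassociative, nonunital) product and whose extra
  field \<open>homog\<close> gives the homogeneous components.  The \<open>one\<close> field inherited from rings is never
  used.  A graded space \<open>M\<close> is the same record with the product disregarded.
\<close>

record ('k, 'v, 'g) graded_algebra = "('k, 'v) module" +
  homog :: "'g \<Rightarrow> 'v set"

text \<open>\<open>d\<close> exhibits \<open>x\<close> as a finite sum of elements \<open>d g \<in> V g\<close>.\<close>

definition hdecomp ::
  "('g, 's) monoid_scheme \<Rightarrow> ('k, 'v, 'g) graded_algebra \<Rightarrow> ('g \<Rightarrow> 'v set) \<Rightarrow> 'v \<Rightarrow> ('g \<Rightarrow> 'v) \<Rightarrow> bool"
  where "hdecomp G A V x d \<longleftrightarrow>
    d \<in> (\<Pi>\<^sub>E g\<in>carrier G. V g) \<and>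
    finite {g \<in> carrier G. d g \<noteq> \<zero>\<^bsub>A\<^esub>} \<and>
    x = (\<Oplus>\<^bsub>A\<^esub>g\<in>{g \<in> carrier G. d g \<noteq> \<zero>\<^bsub>A\<^esub>}. d g)"

locale color_algebra = A?: module K A + K?: field K + G: comm_group G
  for K :: "('k, 'r) ring_scheme" and G :: "('g, 's) monoid_scheme"
    and A :: "('k, 'v, 'g) graded_algebra" +
  assumes mult_closed:
      "\<lbrakk>x \<in> carrier A; y \<in> carrier A\<rbrakk> \<Longrightarrow> x \<otimes>\<^bsub>A\<^esub> y \<in> carrier A"
    and mult_add_left:
      "\<lbrakk>x \<in> carrier A; y \<in> carrier A; z \<in> carrier A\<rbrakk>
        \<Longrightarrow> (x \<oplus>\<^bsub>A\<^esub> y) \<otimes>\<^bsub>A\<^esub> z = x \<otimes>\<^bsub>A\<^esub> z \<oplus>\<^bsub>A\<^esub> y \<otimes>\<^bsub>A\<^esub> z"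
    and mult_add_right:
      "\<lbrakk>x \<in> carrier A; y \<in> carrier A; z \<in> carrier A\<rbrakk>
        \<Longrightarrow> x \<otimes>\<^bsub>A\<^esub> (y \<oplus>\<^bsub>A\<^esub> z) = x \<otimes>\<^bsub>A\<^esub> y \<oplus>\<^bsub>A\<^esub> x \<otimes>\<^bsub>A\<^esub> z"
    and mult_smult_left:
      "\<lbrakk>c \<in> carrier K; x \<in> carrier A; y \<in> carrier A\<rbrakk>
        \<Longrightarrow> (c \<odot>\<^bsub>A\<^esub> x) \<otimes>\<^bsub>A\<^esub> y = c \<odot>\<^bsub>A\<^esub> (x \<otimes>\<^bsub>A\<^esub> y)"
    and mult_smult_right:
      "\<lbrakk>c \<in> carrier K; x \<in> carrier A; y \<in> carrier A\<rbrakk>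
        \<Longrightarrow> x \<otimes>\<^bsub>A\<^esub> (c \<odot>\<^bsub>A\<^esub> y) = c \<odot>\<^bsub>A\<^esub> (x \<otimes>\<^bsub>A\<^esub> y)"
    and homog_submodule:
      "g \<in> carrier G \<Longrightarrow> submodule (homog A g) K A"
    and homog_direct_sum:
      "x \<in> carrier A \<Longrightarrow> \<exists>!d. hdecomp G A (homog A) x d"
    and homog_mult:
      "\<lbrakk>g \<in> carrier G; h \<in> carrier G; x \<in> homog A g; y \<in> homog A h\<rbrakk>
        \<Longrightarrow> x \<otimes>\<^bsub>A\<^esub> y \<in> homog A (g \<otimes>\<^bsub>G\<^esub> h)"

definition color_hom ::
  "('k, 'r) ring_scheme \<Rightarrow> ('g, 's) monoid_scheme \<Rightarrow> ('k, 'v, 'g) graded_algebra \<Rightarrow>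
    ('k, 'w, 'g) graded_algebra \<Rightarrow> ('v \<Rightarrow> 'w) set"
  where "color_hom K G A B =
    {h. h \<in> carrier A \<rightarrow> carrier B \<and>
      (\<forall>x\<in>carrier A. \<forall>y\<in>carrier A. h (x \<oplus>\<^bsub>A\<^esub> y) = h x \<oplus>\<^bsub>B\<^esub> h y) \<and>
      (\<forall>c\<in>carrier K. \<forall>x\<in>carrier A. h (c \<odot>\<^bsub>A\<^esub> x) = c \<odot>\<^bsub>B\<^esub> h x) \<and>
      (\<forall>x\<in>carrier A. \<forall>y\<in>carrier A. h (x \<otimes>\<^bsub>A\<^esub> y) = h x \<otimes>\<^bsub>B\<^esub> h y) \<and>
      (\<forall>g\<in>carrier G. \<forall>x\<in>homog A g. h x \<in> homog B g)}"

locale skew_bicharacter = K?: field K + G: comm_group G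
  for K :: "('k, 'r) ring_scheme" and G :: "('g, 's) monoid_scheme" +
  fixes \<chi> :: "'g \<Rightarrow> 'g \<Rightarrow> 'k"
  assumes bichar_unit:
      "\<lbrakk>a \<in> carrier G; b \<in> carrier G\<rbrakk> \<Longrightarrow> \<chi> a b \<in> Units K"
    and bichar_left:
      "\<lbrakk>a \<in> carrier G; b \<in> carrier G; c \<in> carrier G\<rbrakk>
        \<Longrightarrow> \<chi> (a \<otimes>\<^bsub>G\<^esub> b) c = \<chi> a c \<otimes>\<^bsub>K\<^esub> \<chi> b c"
    and bichar_right:
      "\<lbrakk>a \<in> carrier G; b \<in> carrier G; c \<in> carrier G\<rbrakk>
        \<Longrightarrow> \<chi> a (b \<otimes>\<^bsub>G\<^esub> c) = \<chi> a b \<otimes>\<^bsub>K\<^esub> \<chi> a c"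
    and bichar_skew:
      "\<lbrakk>a \<in> carrier G; b \<in> carrier G\<rbrakk> \<Longrightarrow> \<chi> a b \<otimes>\<^bsub>K\<^esub> \<chi> b a = \<one>\<^bsub>K\<^esub>"

text \<open>
  Statements about homogeneous elements quantify over a degree \<open>g\<close> and an element of \<open>homog A g\<close>.
  The zero element thereby has every degree.  The product of \<open>M\<close> is the bracket.
\<close>

locale malcev_color_algebra = color_algebra K G M + skew_bicharacter K G \<chi>
  for K :: "('k, 'r) ring_scheme" and G :: "('g, 's) monoid_scheme"
    and \<chi> :: "'g \<Rightarrow> 'g \<Rightarrow> 'k" and M :: "('k, 'v, 'g) graded_algebra" +
  assumes color_antisym:
      "\<lbrakk>g \<in> carrier G; h \<in> carrier G; a \<in> homog M g; b \<in> homog M h\<rbrakk>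
        \<Longrightarrow> a \<otimes>\<^bsub>M\<^esub> b = \<ominus>\<^bsub>M\<^esub> (\<chi> g h \<odot>\<^bsub>M\<^esub> (b \<otimes>\<^bsub>M\<^esub> a))"
    and color_malcev:
      "\<lbrakk>gx \<in> carrier G; gy \<in> carrier G; gz \<in> carrier G; gw \<in> carrier G;
        x \<in> homog M gx; y \<in> homog M gy; z \<in> homog M gz; w \<in> homog M gw\<rbrakk>
        \<Longrightarrow> \<chi> gy gz \<odot>\<^bsub>M\<^esub> ((x \<otimes>\<^bsub>M\<^esub> z) \<otimes>\<^bsub>M\<^esub> (y \<otimes>\<^bsub>M\<^esub> w)) =
          ((x \<otimes>\<^bsub>M\<^esub> y) \<otimes>\<^bsub>M\<^esub> z) \<otimes>\<^bsub>M\<^esub> w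
          \<oplus>\<^bsub>M\<^esub> (\<chi> gx gy \<otimes>\<^bsub>K\<^esub> \<chi> gx gz \<otimes>\<^bsub>K\<^esub> \<chi> gx gw)
            \<odot>\<^bsub>M\<^esub> (((y \<otimes>\<^bsub>M\<^esub> z) \<otimes>\<^bsub>M\<^esub> w) \<otimes>\<^bsub>M\<^esub> x)
          \<oplus>\<^bsub>M\<^esub> (\<chi> gy gz \<otimes>\<^bsub>K\<^esub> \<chi> gx gz \<otimes>\<^bsub>K\<^esub> \<chi> gy gw \<otimes>\<^bsub>K\<^esub> \<chi> gx gw)
            \<odot>\<^bsub>M\<^esub> (((z \<otimes>\<^bsub>M\<^esub> w) \<otimes>\<^bsub>M\<^esub> x) \<otimes>\<^bsub>M\<^esub> y)
          \<oplus>\<^bsub>M\<^esub> (\<chi> gz gw \<otimes>\<^bsub>K\<^esub> \<chi> gy gw \<otimes>\<^bsub>K\<^esub> \<chi> gx gw)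
            \<odot>\<^bsub>M\<^esub> (((w \<otimes>\<^bsub>M\<^esub> x) \<otimes>\<^bsub>M\<^esub> y) \<otimes>\<^bsub>M\<^esub> z)"

definition associator :: "('k, 'v, 'g) graded_algebra \<Rightarrow> 'v \<Rightarrow> 'v \<Rightarrow> 'v \<Rightarrow> 'v"
  where "associator A a b c = (a \<otimes>\<^bsub>A\<^esub> b) \<otimes>\<^bsub>A\<^esub> c \<ominus>\<^bsub>A\<^esub> a \<otimes>\<^bsub>A\<^esub> (b \<otimes>\<^bsub>A\<^esub> c)"

definition hcomp ::
  "('g, 's) monoid_scheme \<Rightarrow> ('k, 'v, 'g) graded_algebra \<Rightarrow> 'v \<Rightarrow> 'g \<Rightarrow> 'v"
  where "hcomp G A x = (THE d. hdecomp G A (homog A) x d)"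

definition hsupp ::
  "('g, 's) monoid_scheme \<Rightarrow> ('k, 'v, 'g) graded_algebra \<Rightarrow> 'v \<Rightarrow> 'g set"
  where "hsupp G A x = {g \<in> carrier G. hcomp G A x g \<noteq> \<zero>\<^bsub>A\<^esub>}"

text \<open>The biadditive extension of \<open>[a,b] = ab - \<chi>(a,b)ba\<close> from homogeneous to arbitrary elements.\<close>

definition color_bracket ::
  "('g, 's) monoid_scheme \<Rightarrow> ('g \<Rightarrow> 'g \<Rightarrow> 'k) \<Rightarrow> ('k, 'v, 'g) graded_algebra \<Rightarrow> 'v \<Rightarrow> 'v \<Rightarrow> 'v"
  where "color_bracket G \<chi> A a b =
    (\<Oplus>\<^bsub>A\<^esub>p\<in>hsupp G A a \<times> hsupp G A b.
      hcomp G A a (fst p) \<otimes>\<^bsub>A\<^esub> hcomp G A b (snd p)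
      \<ominus>\<^bsub>A\<^esub> \<chi> (fst p) (snd p) \<odot>\<^bsub>A\<^esub> (hcomp G A b (snd p) \<otimes>\<^bsub>A\<^esub> hcomp G A a (fst p)))"

definition nucleus_homog ::
  "('g, 's) monoid_scheme \<Rightarrow> ('g \<Rightarrow> 'g \<Rightarrow> 'k) \<Rightarrow> ('k, 'v, 'g) graded_algebra \<Rightarrow> 'g \<Rightarrow> 'v set"
  where "nucleus_homog G \<chi> A g =
    {x \<in> homog A g. \<forall>h\<in>carrier G. \<forall>k\<in>carrier G. \<forall>y\<in>homog A h. \<forall>z\<in>homog A k.
      associator A x y z = \<ominus>\<^bsub>A\<^esub> (\<chi> g h \<odot>\<^bsub>A\<^esub> associator A y x z) \<and>
      associator A y z x = \<ominus>\<^bsub>A\<^esub> (\<chi> k g \<odot>\<^bsub>A\<^esub> associator A y x z)}"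

definition color_nucleus ::
  "('g, 's) monoid_scheme \<Rightarrow> ('g \<Rightarrow> 'g \<Rightarrow> 'k) \<Rightarrow> ('k, 'v, 'g) graded_algebra \<Rightarrow> 'v set"
  where "color_nucleus G \<chi> A = {x. \<exists>d. hdecomp G A (nucleus_homog G \<chi> A) x d}"

definition color_nucleus_minus ::
  "('g, 's) monoid_scheme \<Rightarrow> ('g \<Rightarrow> 'g \<Rightarrow> 'k) \<Rightarrow> ('k, 'v, 'g) graded_algebra \<Rightarrow>
    ('k, 'v, 'g) graded_algebra"
  where "color_nucleus_minus G \<chi> A =
    A\<lparr>carrier := color_nucleus G \<chi> A, mult := color_bracket G \<chi> A,
      homog := nucleus_homog G \<chi> A\<rparr>"

definition alg_ideal ::
  "('k, 'r) ring_scheme \<Rightarrow> ('k, 'v, 'g) graded_algebra \<Rightarrow> 'v set \<Rightarrow> bool"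
  where "alg_ideal K A I \<longleftrightarrow> submodule I K A \<and>
    (\<forall>a\<in>carrier A. \<forall>x\<in>I. a \<otimes>\<^bsub>A\<^esub> x \<in> I \<and> x \<otimes>\<^bsub>A\<^esub> a \<in> I)"

definition alg_idl ::
  "('k, 'r) ring_scheme \<Rightarrow> ('k, 'v, 'g) graded_algebra \<Rightarrow> 'v set \<Rightarrow> 'v set"
  where "alg_idl K A S = \<Inter>{I. alg_ideal K A I \<and> S \<subseteq> I}"

definition quot_alg ::
  "('k, 'v, 'g) graded_algebra \<Rightarrow> 'v set \<Rightarrow> ('k, 'v set, 'g) graded_algebra"
  where "quot_alg A I =
    \<lparr>carrier = a_rcosets\<^bsub>A\<^esub> I, mult = rcoset_mult A I, one = I +>\<^bsub>A\<^esub> \<one>\<^bsub>A\<^esub>,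
     zero = I, add = set_add A,
     smult = (\<lambda>c C. \<Union>x\<in>C. I +>\<^bsub>A\<^esub> (c \<odot>\<^bsub>A\<^esub> x)),
     homog = (\<lambda>g. (\<lambda>x. I +>\<^bsub>A\<^esub> x) ` homog A g)\<rparr>"

datatype 'v magma = Gen 'v | Prod "'v magma" "'v magma"

inductive magma_homog ::
  "('g, 's) monoid_scheme \<Rightarrow> ('k, 'v, 'g) graded_algebra \<Rightarrow> 'v magma \<Rightarrow> 'g \<Rightarrow> bool"
  for G :: "('g, 's) monoid_scheme" and M :: "('k, 'v, 'g) graded_algebra"
  where
    "\<lbrakk>g \<in> carrier G; x \<in> homog M g\<rbrakk> \<Longrightarrow> magma_homog G M (Gen x) g"
  | "\<lbrakk>magma_homog G M s g; magma_homog G M t h\<rbrakk> \<Longrightarrow> magma_homog G M (Prod s t) (g \<otimes>\<^bsub>G\<^esub> h)"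

text \<open>
  The free nonassociative algebra on the underlying set of \<open>M\<close>, i.e. the magma algebra of the free
  magma: finitely supported \<open>K\<close>-valued functions with the convolution product.  Its \<open>homog\<close> field
  does not yet define a grading (words containing a non-homogeneous letter have no degree); it does
  once the linear relations of \<open>M\<close> have been divided out in \<open>free_alg\<close>.
\<close>

definition magma_alg ::
  "('k, 'r) ring_scheme \<Rightarrow> ('g, 's) monoid_scheme \<Rightarrow> ('k, 'v, 'g) graded_algebra \<Rightarrow>
    ('k, 'v magma \<Rightarrow> 'k, 'g) graded_algebra"
  where "magma_alg K G M =
    \<lparr>carrier = {p. (\<forall>t. p t \<in> carrier K) \<and> finite {t. p t \<noteq> \<zero>\<^bsub>K\<^esub>} \<and>
                  (\<forall>t. p t \<noteq> \<zero>\<^bsub>K\<^esub> \<longrightarrow> set_magma t \<subseteq> carrier M)},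
     mult = (\<lambda>p q t. case t of Gen x \<Rightarrow> \<zero>\<^bsub>K\<^esub> | Prod s u \<Rightarrow> p s \<otimes>\<^bsub>K\<^esub> q u),
     one = (\<lambda>t. \<zero>\<^bsub>K\<^esub>),
     zero = (\<lambda>t. \<zero>\<^bsub>K\<^esub>),
     add = (\<lambda>p q t. p t \<oplus>\<^bsub>K\<^esub> q t),
     smult = (\<lambda>c p t. c \<otimes>\<^bsub>K\<^esub> p t),
     homog = (\<lambda>g. {p. (\<forall>t. p t \<in> carrier K) \<and> finite {t. p t \<noteq> \<zero>\<^bsub>K\<^esub>} \<and>
                  (\<forall>t. p t \<noteq> \<zero>\<^bsub>K\<^esub> \<longrightarrow> set_magma t \<subseteq> carrier M \<and> magma_homog G M t g)})\<rparr>"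

definition magma_gen :: "('k, 'r) ring_scheme \<Rightarrow> 'v \<Rightarrow> 'v magma \<Rightarrow> 'k"
  where "magma_gen K x = (\<lambda>t. if t = Gen x then \<one>\<^bsub>K\<^esub> else \<zero>\<^bsub>K\<^esub>)"

text \<open>The relations making \<open>magma_gen\<close> linear.\<close>

definition lin_ideal ::
  "('k, 'r) ring_scheme \<Rightarrow> ('g, 's) monoid_scheme \<Rightarrow> ('k, 'v, 'g) graded_algebra \<Rightarrow>
    ('v magma \<Rightarrow> 'k) set"
  where "lin_ideal K G M =
    (let T = magma_alg K G M; e = magma_gen K in
     alg_idl K T
       ({e (x \<oplus>\<^bsub>M\<^esub> y) \<ominus>\<^bsub>T\<^esub> (e x \<oplus>\<^bsub>T\<^esub> e y) | x y. x \<in> carrier M \<and> y \<in> carrier M} \<union>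
        {e (c \<odot>\<^bsub>M\<^esub> x) \<ominus>\<^bsub>T\<^esub> c \<odot>\<^bsub>T\<^esub> e x | c x. c \<in> carrier K \<and> x \<in> carrier M}))"

text \<open>\<open>K{M}\<close>, the free nonassociative algebra on the graded vector space \<open>M\<close>, and \<open>M \<rightarrow> K{M}\<close>.\<close>

definition free_alg ::
  "('k, 'r) ring_scheme \<Rightarrow> ('g, 's) monoid_scheme \<Rightarrow> ('k, 'v, 'g) graded_algebra \<Rightarrow>
    ('k, ('v magma \<Rightarrow> 'k) set, 'g) graded_algebra"
  where "free_alg K G M = quot_alg (magma_alg K G M) (lin_ideal K G M)"

definition free_incl ::
  "('k, 'r) ring_scheme \<Rightarrow> ('g, 's) monoid_scheme \<Rightarrow> ('k, 'v, 'g) graded_algebra \<Rightarrow>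
    'v \<Rightarrow> ('v magma \<Rightarrow> 'k) set"
  where "free_incl K G M x = lin_ideal K G M +>\<^bsub>magma_alg K G M\<^esub> magma_gen K x"

definition env_ideal ::
  "('k, 'r) ring_scheme \<Rightarrow> ('g, 's) monoid_scheme \<Rightarrow> ('g \<Rightarrow> 'g \<Rightarrow> 'k) \<Rightarrow>
    ('k, 'v, 'g) graded_algebra \<Rightarrow> ('v magma \<Rightarrow> 'k) set set"
  where "env_ideal K G \<chi> M =
    (let F = free_alg K G M; \<iota> = free_incl K G M in
     alg_idl K F
       ({\<iota> x \<otimes>\<^bsub>F\<^esub> \<iota> y \<ominus>\<^bsub>F\<^esub> \<chi> g h \<odot>\<^bsub>F\<^esub> (\<iota> y \<otimes>\<^bsub>F\<^esub> \<iota> x) \<ominus>\<^bsub>F\<^esub> \<iota> (x \<otimes>\<^bsub>M\<^esub> y) | g h x y.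
            g \<in> carrier G \<and> h \<in> carrier G \<and> x \<in> homog M g \<and> y \<in> homog M h} \<union>
        {associator F (\<iota> x) a b \<oplus>\<^bsub>F\<^esub> \<chi> g h \<odot>\<^bsub>F\<^esub> associator F a (\<iota> x) b | g h k x a b.
            g \<in> carrier G \<and> h \<in> carrier G \<and> k \<in> carrier G \<and>
            x \<in> homog M g \<and> a \<in> homog F h \<and> b \<in> homog F k} \<union>
        {associator F a (\<iota> x) b \<oplus>\<^bsub>F\<^esub> \<chi> g k \<odot>\<^bsub>F\<^esub> associator F a b (\<iota> x) | g h k x a b.
            g \<in> carrier G \<and> h \<in> carrier G \<and> k \<in> carrier G \<and>
            x \<in> homog M g \<and> a \<in> homog F h \<and> b \<in> homog F k}))"

definition env_alg ::
  "('k, 'r) ring_scheme \<Rightarrow> ('g, 's) monoid_scheme \<Rightarrow> ('g \<Rightarrow> 'g \<Rightarrow> 'k) \<Rightarrow>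
    ('k, 'v, 'g) graded_algebra \<Rightarrow> ('k, ('v magma \<Rightarrow> 'k) set set, 'g) graded_algebra"
  where "env_alg K G \<chi> M = quot_alg (free_alg K G M) (env_ideal K G \<chi> M)"

definition env_incl ::
  "('k, 'r) ring_scheme \<Rightarrow> ('g, 's) monoid_scheme \<Rightarrow> ('g \<Rightarrow> 'g \<Rightarrow> 'k) \<Rightarrow>
    ('k, 'v, 'g) graded_algebra \<Rightarrow> 'v \<Rightarrow> ('v magma \<Rightarrow> 'k) set set"
  where "env_incl K G \<chi> M x = env_ideal K G \<chi> M +>\<^bsub>free_alg K G M\<^esub> free_incl K G M x"

end

theory Submission
  imports Defs
begin

text \<open>
  The map \<open>f\<close> extends to the magma algebra by evaluating words.  The extension kills the linear
  relations because \<open>f\<close> is linear, the bracket relations because \<open>f\<close> preserves brackets, and the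
  associator relations because \<open>f\<close> maps into the color-alternative nucleus; hence it factors through
  both quotients.  It is unique because words in \<open>M\<close> span the magma algebra.
\<close>

section \<open>Quotients of pregraded algebras\<close>

text \<open>Degrees are tracked from the start because existence depends on them. The identities of
  the nucleus speak of homogeneous \<open>y\<close> and \<open>z\<close>, so the associator
  relations can be killed only once the extension to \<open>free_alg\<close> is known to send
  homogeneous elements to homogeneous elements of the same degree. Hence every intermediate map is a
  \<open>color_hom\<close>, even where the \<open>homog\<close> field of its source is just a family
  of subsets. What a true grading provides is used for the target \<open>A\<close>: its components
  are submodules, which keeps a sum of words of one degree in that degree, and decompositions are
  unique, which evaluates the bracket on homogeneous elements. The second identity of the nucleus
  and the last family of relations carry their factors on different associators; skew-symmetry of
  \<chi> turns one form into the other.\<close>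

text \<open>
  What \<open>magma_alg\<close>, whose \<open>homog\<close> field is not a grading, has in common with its quotients.
\<close>

locale pregraded_algebra = module K A
  for K :: "('k, 'r) ring_scheme" and G :: "('g, 's) monoid_scheme"
    and A :: "('k, 'v, 'g) graded_algebra" +
  assumes mult_closed [simp, intro]:
      "\<lbrakk>x \<in> carrier A; y \<in> carrier A\<rbrakk> \<Longrightarrow> x \<otimes>\<^bsub>A\<^esub> y \<in> carrier A"
    and mult_add_left:
      "\<lbrakk>x \<in> carrier A; y \<in> carrier A; z \<in> carrier A\<rbrakk>
        \<Longrightarrow> (x \<oplus>\<^bsub>A\<^esub> y) \<otimes>\<^bsub>A\<^esub> z = x \<otimes>\<^bsub>A\<^esub> z \<oplus>\<^bsub>A\<^esub> y \<otimes>\<^bsub>A\<^esub> z"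
    and mult_add_right:
      "\<lbrakk>x \<in> carrier A; y \<in> carrier A; z \<in> carrier A\<rbrakk>
        \<Longrightarrow> x \<otimes>\<^bsub>A\<^esub> (y \<oplus>\<^bsub>A\<^esub> z) = x \<otimes>\<^bsub>A\<^esub> y \<oplus>\<^bsub>A\<^esub> x \<otimes>\<^bsub>A\<^esub> z"
    and mult_smult_left:
      "\<lbrakk>c \<in> carrier K; x \<in> carrier A; y \<in> carrier A\<rbrakk>
        \<Longrightarrow> (c \<odot>\<^bsub>A\<^esub> x) \<otimes>\<^bsub>A\<^esub> y = c \<odot>\<^bsub>A\<^esub> (x \<otimes>\<^bsub>A\<^esub> y)"
    and mult_smult_right:
      "\<lbrakk>c \<in> carrier K; x \<in> carrier A; y \<in> carrier A\<rbrakk>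
        \<Longrightarrow> x \<otimes>\<^bsub>A\<^esub> (c \<odot>\<^bsub>A\<^esub> y) = c \<odot>\<^bsub>A\<^esub> (x \<otimes>\<^bsub>A\<^esub> y)"
    and homog_subset: "g \<in> carrier G \<Longrightarrow> homog A g \<subseteq> carrier A"
begin

text \<open>Zero is the multiple of itself by the scalar zero, and bilinearity moves that scalar out
  of the product.\<close>

lemma mult_zero_left [simp]: "x \<in> carrier A \<Longrightarrow> \<zero>\<^bsub>A\<^esub> \<otimes>\<^bsub>A\<^esub> x = \<zero>\<^bsub>A\<^esub>"
  using mult_smult_left[of "\<zero>\<^bsub>K\<^esub>" "\<zero>\<^bsub>A\<^esub>" x] by simp

lemma mult_zero_right [simp]: "x \<in> carrier A \<Longrightarrow> x \<otimes>\<^bsub>A\<^esub> \<zero>\<^bsub>A\<^esub> = \<zero>\<^bsub>A\<^esub>"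
  using mult_smult_right[of "\<zero>\<^bsub>K\<^esub>" x "\<zero>\<^bsub>A\<^esub>"] by simp

lemma diff_self: "x \<in> carrier A \<Longrightarrow> x \<ominus>\<^bsub>A\<^esub> x = \<zero>\<^bsub>A\<^esub>"
  by (simp add: a_minus_def M.r_neg)

lemma uminus_zero: "\<ominus>\<^bsub>A\<^esub> \<zero>\<^bsub>A\<^esub> = \<zero>\<^bsub>A\<^esub>"
  by (simp add: M.add.inv_equality)

lemma associator_closed [simp, intro]:
  "\<lbrakk>x \<in> carrier A; y \<in> carrier A; z \<in> carrier A\<rbrakk> \<Longrightarrow> associator A x y z \<in> carrier A"
  by (simp add: associator_def)

lemma alg_ideal_carrier: "alg_ideal K A (carrier A)"
  by (simp add: alg_ideal_def carrier_is_submodule)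

text \<open>All closure properties pass to intersections, but the intersection lies in the carrier
  only if the family is nonempty. The hypothesis on \<open>S\<close> puts \<open>carrier A\<close>
  itself into the family.\<close>

lemma alg_idl_ideal:
  assumes "S \<subseteq> carrier A"
  shows "alg_ideal K A (alg_idl K A S)"
proof -
  let ?J = "alg_idl K A S"
  have J: "x \<in> ?J \<longleftrightarrow> (\<forall>I. alg_ideal K A I \<longrightarrow> S \<subseteq> I \<longrightarrow> x \<in> I)" for x
    by (auto simp: alg_idl_def)
  have sub: "submodule I K A" if "alg_ideal K A I" for I
    using that by (simp add: alg_ideal_def)
  have "submodule ?J K A"
  proof (rule submoduleI)
    show "?J \<subseteq> carrier A"
      using J alg_ideal_carrier assms by blast
    show "\<zero>\<^bsub>A\<^esub> \<in> ?J"
      unfolding J by (metis sub submodule.axioms(1) subgroup.one_closed monoid.simps(2))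
    show "\<ominus>\<^bsub>A\<^esub> a \<in> ?J" if "a \<in> ?J" for a
      using that unfolding J by (metis sub submoduleE(3))
    show "a \<oplus>\<^bsub>A\<^esub> b \<in> ?J" if "a \<in> ?J" "b \<in> ?J" for a b
      using that unfolding J by (metis sub submoduleE(5))
    show "c \<odot>\<^bsub>A\<^esub> a \<in> ?J" if "c \<in> carrier K" "a \<in> ?J" for c a
      using that unfolding J by (metis sub submoduleE(4))
  qed
  moreover have "a \<otimes>\<^bsub>A\<^esub> x \<in> ?J \<and> x \<otimes>\<^bsub>A\<^esub> a \<in> ?J" if "a \<in> carrier A" "x \<in> ?J" for a x
    using that unfolding J alg_ideal_def by blast
  ultimately show ?thesis
    by (simp add: alg_ideal_def)
qed

end

lemma (in color_algebra) pregraded_algebra: "pregraded_algebra K G A"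
proof
  show "homog A g \<subseteq> carrier A" if "g \<in> carrier G" for g
    using homog_submodule[OF that] by (rule submoduleE(1))
qed (simp_all add: mult_closed mult_add_left mult_add_right mult_smult_left mult_smult_right)

section \<open>Morphisms and their kernels\<close>

lemma color_homD:
  assumes "h \<in> color_hom K G A B"
  shows "x \<in> carrier A \<Longrightarrow> h x \<in> carrier B"
    and "\<lbrakk>x \<in> carrier A; y \<in> carrier A\<rbrakk> \<Longrightarrow> h (x \<oplus>\<^bsub>A\<^esub> y) = h x \<oplus>\<^bsub>B\<^esub> h y"
    and "\<lbrakk>c \<in> carrier K; x \<in> carrier A\<rbrakk> \<Longrightarrow> h (c \<odot>\<^bsub>A\<^esub> x) = c \<odot>\<^bsub>B\<^esub> h x"
    and "\<lbrakk>x \<in> carrier A; y \<in> carrier A\<rbrakk> \<Longrightarrow> h (x \<otimes>\<^bsub>A\<^esub> y) = h x \<otimes>\<^bsub>B\<^esub> h y"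
    and "\<lbrakk>g \<in> carrier G; x \<in> homog A g\<rbrakk> \<Longrightarrow> h x \<in> homog B g"
  using assms by (auto simp: color_hom_def)

lemma color_homI:
  assumes "\<And>x. x \<in> carrier A \<Longrightarrow> h x \<in> carrier B"
    and "\<And>x y. \<lbrakk>x \<in> carrier A; y \<in> carrier A\<rbrakk> \<Longrightarrow> h (x \<oplus>\<^bsub>A\<^esub> y) = h x \<oplus>\<^bsub>B\<^esub> h y"
    and "\<And>c x. \<lbrakk>c \<in> carrier K; x \<in> carrier A\<rbrakk> \<Longrightarrow> h (c \<odot>\<^bsub>A\<^esub> x) = c \<odot>\<^bsub>B\<^esub> h x"
    and "\<And>x y. \<lbrakk>x \<in> carrier A; y \<in> carrier A\<rbrakk> \<Longrightarrow> h (x \<otimes>\<^bsub>A\<^esub> y) = h x \<otimes>\<^bsub>B\<^esub> h y"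
    and "\<And>g x. \<lbrakk>g \<in> carrier G; x \<in> homog A g\<rbrakk> \<Longrightarrow> h x \<in> homog B g"
  shows "h \<in> color_hom K G A B"
  using assms by (auto simp: color_hom_def)

lemma color_hom_comp:
  "\<lbrakk>h \<in> color_hom K G A B; k \<in> color_hom K G B C\<rbrakk> \<Longrightarrow> k \<circ> h \<in> color_hom K G A C"
  by (rule color_homI) (simp_all add: color_homD[of h] color_homD[of k])

locale pregraded_hom = A?: pregraded_algebra K G A + B?: pregraded_algebra K G B
  for K :: "('k, 'r) ring_scheme" and G :: "('g, 's) monoid_scheme"
    and A :: "('k, 'v, 'g) graded_algebra" and B :: "('k, 'w, 'g) graded_algebra" +
  fixes h :: "'v \<Rightarrow> 'w"
  assumes hom: "h \<in> color_hom K G A B"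
begin

lemmas hom_closed [simp, intro] = color_homD(1)[OF hom]
lemmas hom_add [simp] = color_homD(2)[OF hom]
lemmas hom_smult [simp] = color_homD(3)[OF hom]
lemmas hom_mult [simp] = color_homD(4)[OF hom]
lemmas hom_homog = color_homD(5)[OF hom]

lemma hom_zero [simp]: "h \<zero>\<^bsub>A\<^esub> = \<zero>\<^bsub>B\<^esub>"
  using hom_smult[of "\<zero>\<^bsub>K\<^esub>" "\<zero>\<^bsub>A\<^esub>"] by simp

lemma hom_uminus [simp]: "x \<in> carrier A \<Longrightarrow> h (\<ominus>\<^bsub>A\<^esub> x) = \<ominus>\<^bsub>B\<^esub> h x"
  using hom_add[of "\<ominus>\<^bsub>A\<^esub> x" x]
  by (simp add: A.M.l_neg B.M.add.inv_equality)

lemma hom_minus [simp]: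
  "\<lbrakk>x \<in> carrier A; y \<in> carrier A\<rbrakk> \<Longrightarrow> h (x \<ominus>\<^bsub>A\<^esub> y) = h x \<ominus>\<^bsub>B\<^esub> h y"
  by (simp add: a_minus_def)

lemma hom_associator [simp]:
  "\<lbrakk>x \<in> carrier A; y \<in> carrier A; z \<in> carrier A\<rbrakk>
    \<Longrightarrow> h (associator A x y z) = associator B (h x) (h y) (h z)"
  by (simp add: associator_def)

lemma alg_ideal_kernel: "alg_ideal K A {x \<in> carrier A. h x = \<zero>\<^bsub>B\<^esub>}"
  unfolding alg_ideal_def by (auto intro!: A.submoduleI)

text \<open>The kernel is one of the ideals intersected in \<open>alg_idl\<close>. For both
  quotients this reduces the vanishing of a map on an ideal to its vanishing on generators.\<close>

lemma alg_idl_kernel: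
  "\<lbrakk>S \<subseteq> carrier A; \<And>x. x \<in> S \<Longrightarrow> h x = \<zero>\<^bsub>B\<^esub>; x \<in> alg_idl K A S\<rbrakk> \<Longrightarrow> h x = \<zero>\<^bsub>B\<^esub>"
  using alg_ideal_kernel unfolding alg_idl_def by blast

end

section \<open>The quotient by an ideal and its factorization property\<close>

locale alg_quotient = pregraded_algebra K G A
  for K :: "('k, 'r) ring_scheme" and G :: "('g, 's) monoid_scheme"
    and A :: "('k, 'v, 'g) graded_algebra" +
  fixes I :: "'v set"
  assumes ideal: "alg_ideal K A I"
begin

text \<open>This opens the additive coset calculus of HOL-Algebra to ideals of a nonassociative
  algebra.\<close>

lemma abelian_subgroup: "abelian_subgroup I A"
  using ideal M.abelian_group_axioms by (intro abelian_subgroupI3 additive_subgroupI)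
    (auto simp: alg_ideal_def submodule_def)

sublocale abelian_subgroup I A
  by (rule abelian_subgroup)

lemma I_smult: "\<lbrakk>c \<in> carrier K; x \<in> I\<rbrakk> \<Longrightarrow> c \<odot>\<^bsub>A\<^esub> x \<in> I"
  using ideal submoduleE(4) by (auto simp: alg_ideal_def)

lemma I_mult:
  "\<lbrakk>a \<in> carrier A; x \<in> I\<rbrakk> \<Longrightarrow> a \<otimes>\<^bsub>A\<^esub> x \<in> I" "\<lbrakk>a \<in> carrier A; x \<in> I\<rbrakk> \<Longrightarrow> x \<otimes>\<^bsub>A\<^esub> a \<in> I"
  using ideal by (auto simp: alg_ideal_def)

lemma in_cosetE:
  assumes "y \<in> I +>\<^bsub>A\<^esub> x"
  obtains i where "i \<in> I" "y = i \<oplus>\<^bsub>A\<^esub> x"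
  using assms by (auto simp: a_r_coset_def')

lemma coset_eqI: "\<lbrakk>x \<in> carrier A; i \<in> I\<rbrakk> \<Longrightarrow> I +>\<^bsub>A\<^esub> (i \<oplus>\<^bsub>A\<^esub> x) = I +>\<^bsub>A\<^esub> x"
  by (rule a_repr_independence'[symmetric]) (auto simp: a_r_coset_def')

text \<open>The union that defines scalar multiplication in \<open>quot_alg\<close> is a union of
  equal sets, since \<open>I\<close> is stable under scalars, and it is nonempty because
  \<open>x\<close> lies in its own coset.\<close>

lemma coset_smult:
  assumes "c \<in> carrier K" "x \<in> carrier A"
  shows "(\<Union>y\<in>I +>\<^bsub>A\<^esub> x. I +>\<^bsub>A\<^esub> (c \<odot>\<^bsub>A\<^esub> y)) = I +>\<^bsub>A\<^esub> (c \<odot>\<^bsub>A\<^esub> x)"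
proof -
  have "I +>\<^bsub>A\<^esub> (c \<odot>\<^bsub>A\<^esub> y) = I +>\<^bsub>A\<^esub> (c \<odot>\<^bsub>A\<^esub> x)" if "y \<in> I +>\<^bsub>A\<^esub> x" for y
    using that assms by (elim in_cosetE) (simp add: smult_r_distr coset_eqI I_smult)
  then show ?thesis
    using a_rcos_self[OF assms(2)] by blast
qed

lemma coset_mult:
  assumes "x \<in> carrier A" "y \<in> carrier A"
  shows "rcoset_mult A I (I +>\<^bsub>A\<^esub> x) (I +>\<^bsub>A\<^esub> y) = I +>\<^bsub>A\<^esub> (x \<otimes>\<^bsub>A\<^esub> y)"
proof -
  have "I +>\<^bsub>A\<^esub> (x' \<otimes>\<^bsub>A\<^esub> y') = I +>\<^bsub>A\<^esub> (x \<otimes>\<^bsub>A\<^esub> y)"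
    if x': "x' \<in> I +>\<^bsub>A\<^esub> x" and y': "y' \<in> I +>\<^bsub>A\<^esub> y" for x' y'
  proof -
    obtain i where i: "i \<in> I" "x' = i \<oplus>\<^bsub>A\<^esub> x"
      using x' by (rule in_cosetE)
    obtain j where j: "j \<in> I" "y' = j \<oplus>\<^bsub>A\<^esub> y"
      using y' by (rule in_cosetE)
    note ij = i j
    \<comment> \<open>The second factor of the first term stays unexpanded: \<open>i\<close> times
      anything in the carrier is in \<open>I\<close>, so only two terms have to be absorbed, one
      after the other.\<close>
    have "x' \<otimes>\<^bsub>A\<^esub> y' = i \<otimes>\<^bsub>A\<^esub> y' \<oplus>\<^bsub>A\<^esub> (x \<otimes>\<^bsub>A\<^esub> j \<oplus>\<^bsub>A\<^esub> x \<otimes>\<^bsub>A\<^esub> y)"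
      using ij assms by (simp add: mult_add_left mult_add_right M.a_ac)
    then show ?thesis
      using ij assms by (simp add: coset_eqI I_mult)
  qed
  then show ?thesis
    using a_rcos_self[OF assms(1)] a_rcos_self[OF assms(2)] unfolding rcoset_mult_def by blast
qed

lemma quot_carrier: "carrier (quot_alg A I) = (\<lambda>x. I +>\<^bsub>A\<^esub> x) ` carrier A"
  by (auto simp: quot_alg_def A_RCOSETS_def')

text \<open>The zero of the quotient is stored as \<open>I\<close>; written as a coset it fits the
  rules \<open>proj_simps\<close>.\<close>

lemma quot_zero: "\<zero>\<^bsub>quot_alg A I\<^esub> = I +>\<^bsub>A\<^esub> \<zero>\<^bsub>A\<^esub>"
  by (simp add: quot_alg_def M.a_coset_add_zero a_subset)

lemma proj_hom: "(\<lambda>x. I +>\<^bsub>A\<^esub> x) \<in> color_hom K G A (quot_alg A I)"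
  by (rule color_homI)
    (auto simp: quot_carrier, auto simp: quot_alg_def a_rcos_sum coset_smult coset_mult)

text \<open>Read from right to left, the projection rules move operations on cosets to
  representatives, so that each axiom of the quotient reduces to the same axiom in
  \<open>A\<close>.\<close>

lemmas proj_simps = color_homD(2-4)[OF proj_hom, symmetric]

lemma quot_pregraded: "pregraded_algebra K G (quot_alg A I)"
proof (intro pregraded_algebra.intro moduleI pregraded_algebra_axioms.intro abelian_groupI)
  fix x assume "x \<in> carrier (quot_alg A I)"
  then obtain x0 where x0: "x = I +>\<^bsub>A\<^esub> x0" "x0 \<in> carrier A"
    by (auto simp: quot_carrier)
  then show "\<exists>y\<in>carrier (quot_alg A I). y \<oplus>\<^bsub>quot_alg A I\<^esub> x = \<zero>\<^bsub>quot_alg A I\<^esub>"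
    by (intro bexI[of _ "I +>\<^bsub>A\<^esub> (\<ominus>\<^bsub>A\<^esub> x0)"])
      (auto simp: quot_carrier quot_zero proj_simps l_neg)
next
  show "homog (quot_alg A I) g \<subseteq> carrier (quot_alg A I)" if "g \<in> carrier G" for g
    using homog_subset[OF that] unfolding quot_carrier by (auto simp: quot_alg_def)
qed (use R.cring_axioms in \<open>auto simp: quot_carrier quot_zero proj_simps M.a_ac
  mult_add_left mult_add_right mult_smult_left mult_smult_right
  smult_l_distr smult_r_distr smult_assoc1\<close>)

lemma hom_factor:
  assumes B: "pregraded_algebra K G B" and h: "h \<in> color_hom K G A B"
    and ker: "\<And>x. x \<in> I \<Longrightarrow> h x = \<zero>\<^bsub>B\<^esub>"
  obtains k where "k \<in> color_hom K G (quot_alg A I) B"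
    and "\<And>x. x \<in> carrier A \<Longrightarrow> k (I +>\<^bsub>A\<^esub> x) = h x"
proof
  interpret h: pregraded_hom K G A B h
    using B h pregraded_algebra_axioms by (intro pregraded_hom.intro pregraded_hom_axioms.intro)
  \<comment> \<open>Any representative serves: two elements of a coset differ by an element of
    \<open>I\<close>, where \<open>h\<close> vanishes.\<close>
  define k where "k C = h (SOME x. x \<in> C)" for C
  show k: "k (I +>\<^bsub>A\<^esub> x) = h x" if x: "x \<in> carrier A" for x
  proof -
    have "(SOME y. y \<in> I +>\<^bsub>A\<^esub> x) \<in> I +>\<^bsub>A\<^esub> x"
      using a_rcos_self[OF x] by (rule someI)
    then show ?thesis
      using x by (auto simp: k_def ker elim!: in_cosetE)
  qed
  show "k \<in> color_hom K G (quot_alg A I) B"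
  proof (rule color_homI)
    \<comment> \<open>A homogeneous class has a homogeneous representative \<open>x0\<close> by the
      definition of \<open>homog\<close> in the quotient. The choice in \<open>k\<close> may pick
      another one, but the value is still \<open>h x0\<close>.\<close>
    fix g x assume g: "g \<in> carrier G" "x \<in> homog (quot_alg A I) g"
    then obtain x0 where "x = I +>\<^bsub>A\<^esub> x0" "x0 \<in> homog A g"
      by (auto simp: quot_alg_def)
    then show "k x \<in> homog B g"
      using g homog_subset[OF g(1)] h.hom_homog[OF g(1), of x0] k[of x0] by auto
  qed (auto simp: quot_carrier proj_simps k)
qed

end

section \<open>The magma algebra\<close>

text \<open>These are the basis vectors of the magma algebra, indexed by all words and not only by
  letters.\<close>

definition magma_word :: "('k, 'r) ring_scheme \<Rightarrow> 'v magma \<Rightarrow> 'v magma \<Rightarrow> 'k"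
  where "magma_word K s = (\<lambda>t. if t = s then \<one>\<^bsub>K\<^esub> else \<zero>\<^bsub>K\<^esub>)"

lemma magma_gen_word: "magma_gen K x = magma_word K (Gen x)"
  by (simp add: magma_gen_def magma_word_def)

locale magma_algebra = field K
  for K :: "('k, 'r) ring_scheme" and G :: "('g, 's) monoid_scheme"
    and M :: "('k, 'v, 'g) graded_algebra"
begin

abbreviation "T \<equiv> magma_alg K G M"

lemma magma_simps:
  "p \<oplus>\<^bsub>T\<^esub> q = (\<lambda>t. p t \<oplus>\<^bsub>K\<^esub> q t)"
  "c \<odot>\<^bsub>T\<^esub> p = (\<lambda>t. c \<otimes>\<^bsub>K\<^esub> p t)"
  "\<zero>\<^bsub>T\<^esub> = (\<lambda>t. \<zero>\<^bsub>K\<^esub>)"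
  "p \<otimes>\<^bsub>T\<^esub> q = (\<lambda>t. case t of Gen x \<Rightarrow> \<zero>\<^bsub>K\<^esub> | Prod s u \<Rightarrow> p s \<otimes>\<^bsub>K\<^esub> q u)"
  by (simp_all add: magma_alg_def)

lemma magma_carrier:
  "p \<in> carrier T \<longleftrightarrow> (\<forall>t. p t \<in> carrier K) \<and> finite {t. p t \<noteq> \<zero>\<^bsub>K\<^esub>} \<and>
    (\<forall>t. p t \<noteq> \<zero>\<^bsub>K\<^esub> \<longrightarrow> set_magma t \<subseteq> carrier M)"
  by (simp add: magma_alg_def)

lemma magma_homog_iff:
  "p \<in> homog T g \<longleftrightarrow> p \<in> carrier T \<and> (\<forall>t. p t \<noteq> \<zero>\<^bsub>K\<^esub> \<longrightarrow> magma_homog G M t g)"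
  by (auto simp: magma_alg_def)

lemma magma_add_closed:
  assumes "p \<in> carrier T" "q \<in> carrier T"
  shows "p \<oplus>\<^bsub>T\<^esub> q \<in> carrier T"
proof -
  have "{t. p t \<oplus>\<^bsub>K\<^esub> q t \<noteq> \<zero>\<^bsub>K\<^esub>} \<subseteq> {t. p t \<noteq> \<zero>\<^bsub>K\<^esub>} \<union> {t. q t \<noteq> \<zero>\<^bsub>K\<^esub>}"
    by auto
  moreover have "p t \<noteq> \<zero>\<^bsub>K\<^esub> \<or> q t \<noteq> \<zero>\<^bsub>K\<^esub>" if "p t \<oplus>\<^bsub>K\<^esub> q t \<noteq> \<zero>\<^bsub>K\<^esub>" for t
    using that by auto
  ultimately show ?thesis
    using assms unfolding magma_carrier magma_simps
    by (meson a_closed finite_UnI finite_subset)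
qed

lemma magma_smult_closed:
  assumes "c \<in> carrier K" "p \<in> carrier T"
  shows "c \<odot>\<^bsub>T\<^esub> p \<in> carrier T"
proof -
  have "{t. c \<otimes>\<^bsub>K\<^esub> p t \<noteq> \<zero>\<^bsub>K\<^esub>} \<subseteq> {t. p t \<noteq> \<zero>\<^bsub>K\<^esub>}"
    using assms(1) by auto
  then show ?thesis
    using assms unfolding magma_carrier magma_simps
    by (auto intro: finite_subset)
qed

text \<open>A word of the free magma splits in at most one way, so each coefficient of the
  convolution is a single product. The support of the result therefore consists of words
  \<open>Prod s u\<close> with \<open>s\<close> and \<open>u\<close> from two finite
  supports.\<close>

lemma magma_mult_closed:
  assumes "p \<in> carrier T" "q \<in> carrier T"
  shows "p \<otimes>\<^bsub>T\<^esub> q \<in> carrier T"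
proof -
  have "{t. (p \<otimes>\<^bsub>T\<^esub> q) t \<noteq> \<zero>\<^bsub>K\<^esub>} \<subseteq>
      (\<lambda>(s, u). Prod s u) ` ({t. p t \<noteq> \<zero>\<^bsub>K\<^esub>} \<times> {t. q t \<noteq> \<zero>\<^bsub>K\<^esub>})"
    using assms unfolding magma_carrier magma_simps
    by (auto split: magma.splits simp: image_iff) (metis integral_iff magma.exhaust)
  moreover have "finite ({t. p t \<noteq> \<zero>\<^bsub>K\<^esub>} \<times> {t. q t \<noteq> \<zero>\<^bsub>K\<^esub>})"
    using assms unfolding magma_carrier by blast
  ultimately have "finite {t. (p \<otimes>\<^bsub>T\<^esub> q) t \<noteq> \<zero>\<^bsub>K\<^esub>}"
    using finite_surj by blast
  moreover have "set_magma t \<subseteq> carrier M" if "(p \<otimes>\<^bsub>T\<^esub> q) t \<noteq> \<zero>\<^bsub>K\<^esub>" for t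
  proof (cases t)
    case (Gen x)
    then show ?thesis using that by (simp add: magma_simps)
  next
    case (Prod s u)
    then have "p s \<noteq> \<zero>\<^bsub>K\<^esub>" "q u \<noteq> \<zero>\<^bsub>K\<^esub>"
      using that assms unfolding magma_carrier by (auto simp: magma_simps)
    then show ?thesis
      using assms Prod unfolding magma_carrier by auto
  qed
  moreover have "(p \<otimes>\<^bsub>T\<^esub> q) t \<in> carrier K" for t
    using assms unfolding magma_carrier magma_simps by (auto split: magma.splits)
  ultimately show ?thesis
    unfolding magma_carrier by blast
qed

lemma magma_zero_closed: "\<zero>\<^bsub>T\<^esub> \<in> carrier T"
  by (simp add: magma_carrier magma_simps)

lemma magma_pregraded: "pregraded_algebra K G T"
proof (intro pregraded_algebra.intro moduleI pregraded_algebra_axioms.intro abelian_groupI)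
  fix p assume p: "p \<in> carrier T"
  show "\<exists>q\<in>carrier T. q \<oplus>\<^bsub>T\<^esub> p = \<zero>\<^bsub>T\<^esub>"
  proof
    \<comment> \<open>The negative is taken as a scalar multiple, which inherits finite support from
      closure under scalars.\<close>
    show "(\<ominus>\<^bsub>K\<^esub> \<one>\<^bsub>K\<^esub>) \<odot>\<^bsub>T\<^esub> p \<in> carrier T"
      using p by (simp add: magma_smult_closed)
    show "(\<ominus>\<^bsub>K\<^esub> \<one>\<^bsub>K\<^esub>) \<odot>\<^bsub>T\<^esub> p \<oplus>\<^bsub>T\<^esub> p = \<zero>\<^bsub>T\<^esub>"
      using p by (auto simp: magma_carrier magma_simps l_minus l_neg)
  qed
next
  show "homog T g \<subseteq> carrier T" for g
    by (auto simp: magma_homog_iff)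
qed (use cring_axioms in \<open>simp_all add: magma_add_closed magma_smult_closed magma_mult_closed
    magma_zero_closed\<close>, auto simp: magma_simps magma_carrier fun_eq_iff a_ac m_ac l_distr r_distr
    split: magma.splits)

lemma word_closed: "set_magma t \<subseteq> carrier M \<Longrightarrow> magma_word K t \<in> carrier T"
  by (auto simp: magma_carrier magma_word_def)

lemma gen_closed: "x \<in> carrier M \<Longrightarrow> magma_gen K x \<in> carrier T"
  by (simp add: magma_gen_word word_closed)

lemma word_Prod: "magma_word K s \<otimes>\<^bsub>T\<^esub> magma_word K t = magma_word K (Prod s t)"
  by (auto simp: magma_simps magma_word_def fun_eq_iff split: magma.splits)

text \<open>This is the spanning property in the form of an induction rule: a finitely supported
  function is built from basis vectors by removing one coefficient at a time.\<close>

lemma magma_induct [consumes 1, case_names zero word add smult]: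
  assumes "p \<in> carrier T"
    and zero: "P \<zero>\<^bsub>T\<^esub>"
    and word: "\<And>t. set_magma t \<subseteq> carrier M \<Longrightarrow> P (magma_word K t)"
    and add: "\<And>p q. \<lbrakk>p \<in> carrier T; q \<in> carrier T; P p; P q\<rbrakk> \<Longrightarrow> P (p \<oplus>\<^bsub>T\<^esub> q)"
    and smult: "\<And>c p. \<lbrakk>c \<in> carrier K; p \<in> carrier T; P p\<rbrakk> \<Longrightarrow> P (c \<odot>\<^bsub>T\<^esub> p)"
  shows "P p"
proof -
  \<comment> \<open>The induction runs over a finite set that merely contains the support, so a step
    may meet a coefficient that is already zero.\<close>
  have "P p" if "finite S" "p \<in> carrier T" "{t. p t \<noteq> \<zero>\<^bsub>K\<^esub>} \<subseteq> S" for S p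
    using that
  proof (induction S arbitrary: p)
    case empty
    then have "p = \<zero>\<^bsub>T\<^esub>"
      by (auto simp: magma_simps)
    then show ?case
      using zero by simp
  next
    case (insert t S)
    define q where "q = p(t := \<zero>\<^bsub>K\<^esub>)"
    have "{u. q u \<noteq> \<zero>\<^bsub>K\<^esub>} \<subseteq> {u. p u \<noteq> \<zero>\<^bsub>K\<^esub>}"
      by (auto simp: q_def)
    then have q: "q \<in> carrier T"
      using insert.prems(1) unfolding magma_carrier by (auto simp: q_def intro: finite_subset)
    have "P q"
      using insert.prems(2) by (intro insert.IH q) (auto simp: q_def split: if_splits)
    show ?case
    proof (cases "p t = \<zero>\<^bsub>K\<^esub>")
      case True
      then have "q = p"
        by (auto simp: q_def)
      then show ?thesis
        using \<open>P q\<close> by simp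
    next
      case False
      then have t: "set_magma t \<subseteq> carrier M" and pt: "p t \<in> carrier K"
        using insert.prems(1) by (auto simp: magma_carrier)
      have "p = q \<oplus>\<^bsub>T\<^esub> p t \<odot>\<^bsub>T\<^esub> magma_word K t"
        using insert.prems(1) by (auto simp: magma_carrier magma_simps magma_word_def q_def fun_eq_iff)
      then show ?thesis
        using add[OF q _ \<open>P q\<close> smult[OF pt word_closed[OF t] word[OF t]]]
          magma_smult_closed[OF pt word_closed[OF t]] by simp
    qed
  qed
  then show ?thesis
    using assms(1) by (auto simp: magma_carrier)
qed

text \<open>Linearity reduces the claim to words. On words it is multiplicativity, by induction on
  the tree, with the letters as base case.\<close>

lemma hom_unique:
  assumes B: "pregraded_algebra K G B"
    and h: "h \<in> color_hom K G T B" and k: "k \<in> color_hom K G T B"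
    and eq: "\<And>x. x \<in> carrier M \<Longrightarrow> h (magma_gen K x) = k (magma_gen K x)"
    and p: "p \<in> carrier T"
  shows "h p = k p"
proof -
  interpret h: pregraded_hom K G T B h
    using B h magma_pregraded by (intro pregraded_hom.intro pregraded_hom_axioms.intro)
  interpret k: pregraded_hom K G T B k
    using B k magma_pregraded by (intro pregraded_hom.intro pregraded_hom_axioms.intro)
  have word: "h (magma_word K t) = k (magma_word K t)" if "set_magma t \<subseteq> carrier M" for t
    using that
  proof (induction t)
    case (Gen x)
    then show ?case
      using eq by (simp add: magma_gen_word)
  next
    case (Prod s t)
    then show ?case
      by (simp add: word_Prod[symmetric] word_closed)
  qed
  from p show ?thesis
    by (induction rule: magma_induct) (simp_all add: word)
qed

end

section \<open>Extension of a map on letters by evaluation\<close>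

lemma (in module) submodule_finsum:
  assumes "submodule H R M" "finite S" "\<And>s. s \<in> S \<Longrightarrow> f s \<in> H"
  shows "finsum M f S \<in> H"
  using assms(2,3)
proof (induction S)
  case empty
  then show ?case
    using subgroup.one_closed[OF submodule.axioms(1)[OF assms(1)]] by simp
next
  case (insert s S)
  then have "f \<in> S \<rightarrow> carrier M" "f s \<in> carrier M"
    using submoduleE(1)[OF assms(1)] by auto
  then show ?case
    using insert submoduleE(5)[OF assms(1)] by simp
qed

primrec magma_eval :: "('k, 'a, 'g) graded_algebra \<Rightarrow> ('v \<Rightarrow> 'a) \<Rightarrow> 'v magma \<Rightarrow> 'a"
  where
    "magma_eval A f (Gen x) = f x"
  | "magma_eval A f (Prod s t) = magma_eval A f s \<otimes>\<^bsub>A\<^esub> magma_eval A f t"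

text \<open>Distinct letters are linearly independent in \<open>T\<close>, so any degree-preserving
  map of letters extends. Linearity of \<open>f\<close> matters only when \<open>lin_ideal\<close>
  is divided out.\<close>

lemma (in magma_algebra) hom_extension:
  assumes A: "color_algebra K G A" and f: "f \<in> carrier M \<rightarrow> carrier A"
    and f_homog: "\<And>g x. \<lbrakk>g \<in> carrier G; x \<in> homog M g\<rbrakk> \<Longrightarrow> f x \<in> homog A g"
  obtains h where "h \<in> color_hom K G T A"
    and "\<And>x. x \<in> carrier M \<Longrightarrow> h (magma_gen K x) = f x"
proof
  interpret A': pregraded_algebra K G A
    using A by (rule color_algebra.pregraded_algebra)
  interpret A: color_algebra K G A
    by (rule A)
  let ?ev = "magma_eval A f"
  define h where "h p = (\<Oplus>\<^bsub>A\<^esub>t\<in>{t. p t \<noteq> \<zero>\<^bsub>K\<^esub>}. p t \<odot>\<^bsub>A\<^esub> ?ev t)" for p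
  have ev: "?ev t \<in> carrier A" if "set_magma t \<subseteq> carrier M" for t
    using that f by (induction t) auto
  \<comment> \<open>The first conjunct strengthens the induction: \<open>homog_mult\<close> asks for
    both degrees to lie in \<open>carrier G\<close>.\<close>
  have ev_homog: "g \<in> carrier G \<and> ?ev t \<in> homog A g" if "magma_homog G M t g" for t g
    using that by induction (auto simp: f_homog A.homog_mult)
  have term_closed: "p t \<odot>\<^bsub>A\<^esub> ?ev t \<in> carrier A"
    if "p \<in> carrier T" "set_magma t \<subseteq> carrier M" for p t
    using that ev by (auto simp: magma_carrier)
  \<comment> \<open>Sums over different supports become comparable on a common finite set. Its words
    must use letters of \<open>M\<close>, so that their values lie in \<open>A\<close> and the extra
    terms with coefficient zero vanish.\<close>
  have h_eq: "h p = (\<Oplus>\<^bsub>A\<^esub>t\<in>S. p t \<odot>\<^bsub>A\<^esub> ?ev t)"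
    if "p \<in> carrier T" "finite S" "{t. p t \<noteq> \<zero>\<^bsub>K\<^esub>} \<subseteq> S" "\<And>t. t \<in> S \<Longrightarrow> set_magma t \<subseteq> carrier M"
    for p S
    unfolding h_def using that
    by (intro A'.M.add.finprod_mono_neutral_cong_left) (auto simp: ev term_closed)
  have supp: "finite {t. p t \<noteq> \<zero>\<^bsub>K\<^esub>}"
    "\<And>t. p t \<noteq> \<zero>\<^bsub>K\<^esub> \<Longrightarrow> set_magma t \<subseteq> carrier M" if "p \<in> carrier T" for p
    using that by (auto simp: magma_carrier)
  have h_closed: "h p \<in> carrier A" if "p \<in> carrier T" for p
    unfolding h_def using that supp[OF that]
    by (intro A'.M.finsum_closed) (auto simp: term_closed)
  have h_add: "h (p \<oplus>\<^bsub>T\<^esub> q) = h p \<oplus>\<^bsub>A\<^esub> h q" if p: "p \<in> carrier T" and q: "q \<in> carrier T" for p q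
  proof -
    let ?S = "{t. p t \<noteq> \<zero>\<^bsub>K\<^esub>} \<union> {t. q t \<noteq> \<zero>\<^bsub>K\<^esub>}"
    have S: "finite ?S" "\<And>t. t \<in> ?S \<Longrightarrow> set_magma t \<subseteq> carrier M"
      using supp[OF p] supp[OF q] by auto
    have "h (p \<oplus>\<^bsub>T\<^esub> q) = (\<Oplus>\<^bsub>A\<^esub>t\<in>?S. (p \<oplus>\<^bsub>T\<^esub> q) t \<odot>\<^bsub>A\<^esub> ?ev t)"
      using S by (intro h_eq magma_add_closed p q) (auto simp: magma_simps)
    also have "\<dots> = (\<Oplus>\<^bsub>A\<^esub>t\<in>?S. p t \<odot>\<^bsub>A\<^esub> ?ev t \<oplus>\<^bsub>A\<^esub> q t \<odot>\<^bsub>A\<^esub> ?ev t)"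
      using S p q
      by (intro A'.M.finsum_cong')
        (auto simp: term_closed magma_simps magma_carrier ev A'.smult_l_distr)
    also have "\<dots> = (\<Oplus>\<^bsub>A\<^esub>t\<in>?S. p t \<odot>\<^bsub>A\<^esub> ?ev t) \<oplus>\<^bsub>A\<^esub> (\<Oplus>\<^bsub>A\<^esub>t\<in>?S. q t \<odot>\<^bsub>A\<^esub> ?ev t)"
      using S p q by (intro A'.M.finsum_addf) (auto simp: term_closed)
    also have "\<dots> = h p \<oplus>\<^bsub>A\<^esub> h q"
      using h_eq[OF p S(1) _ S(2)] h_eq[OF q S(1) _ S(2)] by simp
    finally show ?thesis .
  qed
  have h_smult: "h (c \<odot>\<^bsub>T\<^esub> p) = c \<odot>\<^bsub>A\<^esub> h p" if c: "c \<in> carrier K" and p: "p \<in> carrier T" for c p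
  proof -
    let ?S = "{t. p t \<noteq> \<zero>\<^bsub>K\<^esub>}"
    \<comment> \<open>For \<open>c\<close> zero the support shrinks, so the sum is taken over the
      support of \<open>p\<close> instead.\<close>
    have "h (c \<odot>\<^bsub>T\<^esub> p) = (\<Oplus>\<^bsub>A\<^esub>t\<in>?S. (c \<odot>\<^bsub>T\<^esub> p) t \<odot>\<^bsub>A\<^esub> ?ev t)"
      using supp[OF p] c by (intro h_eq magma_smult_closed p) (auto simp: magma_simps)
    also have "\<dots> = (\<Oplus>\<^bsub>A\<^esub>t\<in>?S. c \<odot>\<^bsub>A\<^esub> (p t \<odot>\<^bsub>A\<^esub> ?ev t))"
      using supp[OF p] c p
      by (intro A'.M.finsum_cong')
        (auto simp: term_closed magma_simps magma_carrier ev A'.smult_assoc1)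
    also have "\<dots> = c \<odot>\<^bsub>A\<^esub> h p"
      unfolding h_def using supp[OF p] c p
      by (intro A'.finsum_smult_ldistr[symmetric]) (auto simp: term_closed)
    finally show ?thesis .
  qed
  have h_zero: "h \<zero>\<^bsub>T\<^esub> = \<zero>\<^bsub>A\<^esub>"
    by (simp add: h_def magma_simps)
  have h_word: "h (magma_word K t) = ?ev t" if t: "set_magma t \<subseteq> carrier M" for t
  proof -
    have "h (magma_word K t) = (\<Oplus>\<^bsub>A\<^esub>u\<in>{t}. magma_word K t u \<odot>\<^bsub>A\<^esub> ?ev u)"
      using t by (intro h_eq word_closed) (auto simp: magma_word_def split: if_splits)
    also have "\<dots> = ?ev t"
      using ev[OF t] by (simp add: magma_word_def)
    finally show ?thesis .
  qed
  interpret T: pregraded_algebra K G T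
    by (rule magma_pregraded)
  \<comment> \<open>Both sides are bilinear. Induction on \<open>p\<close>, then on
    \<open>q\<close>, leaves two words \<open>s\<close> and \<open>t\<close>, where the evaluation
    of \<open>Prod s t\<close> is a product by definition.\<close>
  have h_mult: "h (p \<otimes>\<^bsub>T\<^esub> q) = h p \<otimes>\<^bsub>A\<^esub> h q" if p: "p \<in> carrier T" and q: "q \<in> carrier T" for p q
    using p
  proof (induction rule: magma_induct)
    case (word s)
    from q show ?case
    proof (induction rule: magma_induct)
      case (word t)
      then show ?case
        using \<open>set_magma s \<subseteq> carrier M\<close> h_word[of "Prod s t"] by (simp add: word_Prod h_word)
    qed (simp_all add: h_zero h_add h_smult h_closed word word_closed T.mult_add_right
        T.mult_smult_right A'.mult_add_right A'.mult_smult_right)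
  qed (simp_all add: h_zero h_add h_smult h_closed q T.mult_add_left
      T.mult_smult_left A'.mult_add_left A'.mult_smult_left)
  show "h \<in> color_hom K G T A"
  proof (rule color_homI)
    fix g p assume g: "g \<in> carrier G" and p: "p \<in> homog T g"
    have sub: "submodule (homog A g) K A"
      using g by (rule A.homog_submodule)
    \<comment> \<open>All words in the support of \<open>p\<close> have degree \<open>g\<close>, so
      each term lies in the submodule \<open>homog A g\<close>, and so does their finite
      sum.\<close>
    show "h p \<in> homog A g"
      unfolding h_def using p ev_homog
      by (intro A'.submodule_finsum[OF sub])
        (auto simp: magma_homog_iff magma_carrier intro: A'.submoduleE(4)[OF sub])
  qed (simp_all add: h_closed h_add h_smult h_mult)
  show "h (magma_gen K x) = f x" if "x \<in> carrier M" for x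
    using that h_word[of "Gen x"] by (simp add: magma_gen_word)
qed

section \<open>The color bracket\<close>

text \<open>The family concentrated in degree \<open>g\<close> is a decomposition of
  \<open>x\<close>, and uniqueness makes \<open>THE\<close> return it. It is restricted to
  \<open>carrier G\<close> because decompositions are extensional families.\<close>

lemma (in color_algebra) hcomp_homog:
  assumes g: "g \<in> carrier G" and x: "x \<in> homog A g"
  shows "hcomp G A x = (\<lambda>h\<in>carrier G. if h = g then x else \<zero>\<^bsub>A\<^esub>)" (is "_ = ?d")
proof -
  have xA: "x \<in> carrier A"
    using submoduleE(1)[OF homog_submodule[OF g]] x by blast
  have zero: "\<zero>\<^bsub>A\<^esub> \<in> homog A h" if "h \<in> carrier G" for h
    using subgroup.one_closed[OF submodule.axioms(1)[OF homog_submodule[OF that]]] by simp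
  have supp: "{h \<in> carrier G. ?d h \<noteq> \<zero>\<^bsub>A\<^esub>} = (if x = \<zero>\<^bsub>A\<^esub> then {} else {g})"
    using g by auto
  have "hdecomp G A (homog A) x ?d"
    unfolding hdecomp_def supp using g x xA zero by auto
  then show ?thesis
    unfolding hcomp_def using homog_direct_sum[OF xA] by (simp add: the1_equality)
qed

text \<open>For nonzero arguments the sum has the single index \<open>(g, h)\<close>. The zero
  element has every degree but empty support; then the sum is empty and the right side vanishes as
  well.\<close>

lemma (in color_algebra) color_bracket_homog:
  assumes g: "g \<in> carrier G" and h: "h \<in> carrier G" and x: "x \<in> homog A g" and y: "y \<in> homog A h"
    and \<chi>: "\<chi> g h \<in> carrier K"
  shows "color_bracket G \<chi> A x y = x \<otimes>\<^bsub>A\<^esub> y \<ominus>\<^bsub>A\<^esub> \<chi> g h \<odot>\<^bsub>A\<^esub> (y \<otimes>\<^bsub>A\<^esub> x)"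
proof -
  interpret A': pregraded_algebra K G A
    by (rule pregraded_algebra)
  have xy: "x \<in> carrier A" "y \<in> carrier A"
    using A'.homog_subset g h x y by auto
  have supp: "hsupp G A x = (if x = \<zero>\<^bsub>A\<^esub> then {} else {g})"
      "hsupp G A y = (if y = \<zero>\<^bsub>A\<^esub> then {} else {h})"
    unfolding hsupp_def hcomp_homog[OF g x] hcomp_homog[OF h y] using g h by auto
  show ?thesis
    unfolding color_bracket_def supp hcomp_homog[OF g x] hcomp_homog[OF h y]
    using xy g h \<chi> by (auto simp: a_minus_def A'.uminus_zero)
qed

text \<open>Components of the nucleus lie in components of \<open>A\<close>. This lets
  \<open>f\<close> be read as a map into \<open>A\<close>, where words are evaluated.\<close>

lemma (in color_algebra) color_nucleus_subset: "color_nucleus G \<chi> A \<subseteq> carrier A"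
proof
  fix x assume "x \<in> color_nucleus G \<chi> A"
  then obtain d where d: "d \<in> (\<Pi>\<^sub>E g\<in>carrier G. nucleus_homog G \<chi> A g)"
      "x = (\<Oplus>\<^bsub>A\<^esub>g\<in>{g \<in> carrier G. d g \<noteq> \<zero>\<^bsub>A\<^esub>}. d g)"
    by (auto simp: color_nucleus_def hdecomp_def)
  have "d g \<in> carrier A" if "g \<in> carrier G" for g
    using d(1) that submoduleE(1)[OF homog_submodule[OF that]]
    by (auto simp: nucleus_homog_def dest!: PiE_mem)
  then show "x \<in> carrier A"
    unfolding d(2) by (intro A.M.finsum_closed) auto
qed

section \<open>The universal property\<close>

text \<open>The generators inside \<open>lin_ideal\<close> get a name so that closure and vanishing
  can be stated for them alone; \<open>env_rels\<close> does the same for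
  \<open>env_ideal\<close>.\<close>

definition lin_rels ::
  "('k, 'r) ring_scheme \<Rightarrow> ('g, 's) monoid_scheme \<Rightarrow> ('k, 'v, 'g) graded_algebra \<Rightarrow>
    ('v magma \<Rightarrow> 'k) set"
  where "lin_rels K G M =
    (let T = magma_alg K G M; e = magma_gen K in
       {e (x \<oplus>\<^bsub>M\<^esub> y) \<ominus>\<^bsub>T\<^esub> (e x \<oplus>\<^bsub>T\<^esub> e y) | x y. x \<in> carrier M \<and> y \<in> carrier M} \<union>
       {e (c \<odot>\<^bsub>M\<^esub> x) \<ominus>\<^bsub>T\<^esub> c \<odot>\<^bsub>T\<^esub> e x | c x. c \<in> carrier K \<and> x \<in> carrier M})"

lemma lin_ideal_rels: "lin_ideal K G M = alg_idl K (magma_alg K G M) (lin_rels K G M)"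
  by (simp add: lin_ideal_def lin_rels_def Let_def)

definition env_rels ::
  "('k, 'r) ring_scheme \<Rightarrow> ('g, 's) monoid_scheme \<Rightarrow> ('g \<Rightarrow> 'g \<Rightarrow> 'k) \<Rightarrow>
    ('k, 'v, 'g) graded_algebra \<Rightarrow> ('v magma \<Rightarrow> 'k) set set"
  where "env_rels K G \<chi> M =
    (let F = free_alg K G M; \<iota> = free_incl K G M in
       {\<iota> x \<otimes>\<^bsub>F\<^esub> \<iota> y \<ominus>\<^bsub>F\<^esub> \<chi> g h \<odot>\<^bsub>F\<^esub> (\<iota> y \<otimes>\<^bsub>F\<^esub> \<iota> x) \<ominus>\<^bsub>F\<^esub> \<iota> (x \<otimes>\<^bsub>M\<^esub> y) | g h x y.
            g \<in> carrier G \<and> h \<in> carrier G \<and> x \<in> homog M g \<and> y \<in> homog M h} \<union>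
       {associator F (\<iota> x) a b \<oplus>\<^bsub>F\<^esub> \<chi> g h \<odot>\<^bsub>F\<^esub> associator F a (\<iota> x) b | g h k x a b.
            g \<in> carrier G \<and> h \<in> carrier G \<and> k \<in> carrier G \<and>
            x \<in> homog M g \<and> a \<in> homog F h \<and> b \<in> homog F k} \<union>
       {associator F a (\<iota> x) b \<oplus>\<^bsub>F\<^esub> \<chi> g k \<odot>\<^bsub>F\<^esub> associator F a b (\<iota> x) | g h k x a b.
            g \<in> carrier G \<and> h \<in> carrier G \<and> k \<in> carrier G \<and>
            x \<in> homog M g \<and> a \<in> homog F h \<and> b \<in> homog F k})"

lemma env_ideal_rels: "env_ideal K G \<chi> M = alg_idl K (free_alg K G M) (env_rels K G \<chi> M)"
  by (simp add: env_ideal_def env_rels_def Let_def)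

section \<open>The enveloping algebra as an iterated quotient, and its maps into
  \<open>A\<close>\<close>

context malcev_color_algebra
begin

sublocale M': pregraded_algebra K G M
  by (rule pregraded_algebra)

sublocale magma: magma_algebra K G M
  by unfold_locales

sublocale T: pregraded_algebra K G "magma_alg K G M"
  by (rule magma.magma_pregraded)

lemma bichar_closed [simp]: "\<lbrakk>g \<in> carrier G; h \<in> carrier G\<rbrakk> \<Longrightarrow> \<chi> g h \<in> carrier K"
  using bichar_unit by blast

lemma homog_in_carrier: "\<lbrakk>g \<in> carrier G; x \<in> homog M g\<rbrakk> \<Longrightarrow> x \<in> carrier M"
  using M'.homog_subset by blast

lemma lin_rels_closed: "lin_rels K G M \<subseteq> carrier (magma_alg K G M)"
  by (auto simp: lin_rels_def Let_def magma.gen_closed)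

sublocale lin: alg_quotient K G "magma_alg K G M" "lin_ideal K G M"
  by unfold_locales (simp add: lin_ideal_rels T.alg_idl_ideal lin_rels_closed)

sublocale F: pregraded_algebra K G "free_alg K G M"
  unfolding free_alg_def by (rule lin.quot_pregraded)

lemma free_incl_closed [simp]: "x \<in> carrier M \<Longrightarrow> free_incl K G M x \<in> carrier (free_alg K G M)"
  by (simp add: free_incl_def free_alg_def lin.quot_carrier magma.gen_closed)

lemma env_rels_closed: "env_rels K G \<chi> M \<subseteq> carrier (free_alg K G M)"
  using F.homog_subset by (fastforce simp: env_rels_def Let_def homog_in_carrier)

sublocale env: alg_quotient K G "free_alg K G M" "env_ideal K G \<chi> M"
  by unfold_locales (simp add: env_ideal_rels F.alg_idl_ideal env_rels_closed)

lemma env_pregraded: "pregraded_algebra K G (env_alg K G \<chi> M)"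
  unfolding env_alg_def by (rule env.quot_pregraded)

lemma env_incl_closed: "x \<in> carrier M \<Longrightarrow> env_incl K G \<chi> M x \<in> carrier (env_alg K G \<chi> M)"
  by (simp add: env_incl_def env_alg_def env.quot_carrier)

text \<open>The composite \<pi> of the two projections is surjective and sends letters to the values
  of \<open>env_incl\<close>, so it suffices to compare the pullbacks of \<open>h\<close> and
  \<open>k\<close> along \<pi> by \<open>magma.hom_unique\<close>.\<close>

lemma env_hom_unique:
  assumes A: "pregraded_algebra K G A"
    and h: "h \<in> color_hom K G (env_alg K G \<chi> M) A" and k: "k \<in> color_hom K G (env_alg K G \<chi> M) A"
    and eq: "\<And>x. x \<in> carrier M \<Longrightarrow> h (env_incl K G \<chi> M x) = k (env_incl K G \<chi> M x)"
    and u: "u \<in> carrier (env_alg K G \<chi> M)"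
  shows "h u = k u"
proof -
  define \<pi> where "\<pi> p = env_ideal K G \<chi> M +>\<^bsub>free_alg K G M\<^esub> (lin_ideal K G M +>\<^bsub>magma_alg K G M\<^esub> p)"
    for p
  have \<pi>: "\<pi> \<in> color_hom K G (magma_alg K G M) (env_alg K G \<chi> M)"
    using color_hom_comp[OF lin.proj_hom env.proj_hom[unfolded free_alg_def]]
    by (simp add: \<pi>_def[abs_def] comp_def env_alg_def free_alg_def)
  have \<pi>_gen: "\<pi> (magma_gen K x) = env_incl K G \<chi> M x" for x
    by (simp add: \<pi>_def env_incl_def free_incl_def)
  have "(h \<circ> \<pi>) p = (k \<circ> \<pi>) p" if "p \<in> carrier (magma_alg K G M)" for p
    using magma.hom_unique[OF A color_hom_comp[OF \<pi> h] color_hom_comp[OF \<pi> k] _ that]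
    by (simp add: \<pi>_gen eq)
  moreover obtain q where q: "q \<in> carrier (free_alg K G M)"
      "u = env_ideal K G \<chi> M +>\<^bsub>free_alg K G M\<^esub> q"
    using u by (auto simp: env_alg_def env.quot_carrier)
  moreover obtain p where "p \<in> carrier (magma_alg K G M)" "q = lin_ideal K G M +>\<^bsub>magma_alg K G M\<^esub> p"
    using q(1) by (auto simp: free_alg_def lin.quot_carrier)
  ultimately show ?thesis
    by (simp add: \<pi>_def)
qed

lemma env_hom_exists:
  assumes A: "color_algebra K G A"
    and f: "f \<in> color_hom K G M (color_nucleus_minus G \<chi> A)"
  obtains h where "h \<in> color_hom K G (env_alg K G \<chi> M) A"
    and "\<And>x. x \<in> carrier M \<Longrightarrow> h (env_incl K G \<chi> M x) = f x"
proof -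
  interpret A': pregraded_algebra K G A
    using A by (rule color_algebra.pregraded_algebra)
  interpret A: color_algebra K G A
    by (rule A)
  have f_closed: "f x \<in> carrier A" if "x \<in> carrier M" for x
    using color_homD(1)[OF f that] A.color_nucleus_subset by (auto simp: color_nucleus_minus_def)
  have f_add: "f (x \<oplus>\<^bsub>M\<^esub> y) = f x \<oplus>\<^bsub>A\<^esub> f y" if "x \<in> carrier M" "y \<in> carrier M" for x y
    using color_homD(2)[OF f that] by (simp add: color_nucleus_minus_def)
  have f_smult: "f (c \<odot>\<^bsub>M\<^esub> x) = c \<odot>\<^bsub>A\<^esub> f x" if "c \<in> carrier K" "x \<in> carrier M" for c x
    using color_homD(3)[OF f that] by (simp add: color_nucleus_minus_def)
  have f_nucleus: "f x \<in> nucleus_homog G \<chi> A g" if "g \<in> carrier G" "x \<in> homog M g" for g x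
    using color_homD(5)[OF f that] by (simp add: color_nucleus_minus_def)
  then have f_homog: "f x \<in> homog A g" if "g \<in> carrier G" "x \<in> homog M g" for g x
    using that by (auto simp: nucleus_homog_def)
  \<comment> \<open>The bracket in the nucleus is defined through decompositions in
    \<open>A\<close>. Since \<open>f\<close> preserves degrees, it has its closed form on images of
    homogeneous elements, which is the form the bracket relations require.\<close>
  have f_mult: "f (x \<otimes>\<^bsub>M\<^esub> y) = f x \<otimes>\<^bsub>A\<^esub> f y \<ominus>\<^bsub>A\<^esub> \<chi> g h \<odot>\<^bsub>A\<^esub> (f y \<otimes>\<^bsub>A\<^esub> f x)"
    if "g \<in> carrier G" "h \<in> carrier G" "x \<in> homog M g" "y \<in> homog M h" for g h x y
    using color_homD(4)[OF f, of x y] that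
      A.color_bracket_homog[OF that(1,2) f_homog[OF that(1,3)] f_homog[OF that(2,4)]]
    by (simp add: color_nucleus_minus_def homog_in_carrier)
  obtain e where e: "e \<in> color_hom K G (magma_alg K G M) A"
    and e_gen: "\<And>x. x \<in> carrier M \<Longrightarrow> e (magma_gen K x) = f x"
    using magma.hom_extension[OF A, of f] f_closed f_homog by blast
  interpret e: pregraded_hom K G "magma_alg K G M" A e
    using e by unfold_locales
  have "e r = \<zero>\<^bsub>A\<^esub>" if "r \<in> lin_rels K G M" for r
    using that by (auto simp: lin_rels_def Let_def magma.gen_closed e_gen f_add f_smult f_closed
      A'.diff_self)
  then have "e p = \<zero>\<^bsub>A\<^esub>" if "p \<in> lin_ideal K G M" for p
    using that e.alg_idl_kernel[OF lin_rels_closed] by (simp add: lin_ideal_rels)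
  from lin.hom_factor[OF A'.pregraded_algebra_axioms e this]
  obtain e1 where e1: "e1 \<in> color_hom K G (free_alg K G M) A"
    and e1_coset: "\<And>p. p \<in> carrier (magma_alg K G M)
      \<Longrightarrow> e1 (lin_ideal K G M +>\<^bsub>magma_alg K G M\<^esub> p) = e p"
    unfolding free_alg_def by blast
  have e1_incl: "e1 (free_incl K G M x) = f x" if "x \<in> carrier M" for x
    using that by (simp add: free_incl_def e1_coset magma.gen_closed e_gen)
  interpret e1: pregraded_hom K G "free_alg K G M" A e1
    using e1 by unfold_locales
  have "e1 r = \<zero>\<^bsub>A\<^esub>" if "r \<in> env_rels K G \<chi> M" for r
    using that unfolding env_rels_def Let_def
  proof (elim UnE CollectE exE conjE, goal_cases)
    case (1 g h x y)
    then have "x \<in> carrier M" "y \<in> carrier M"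
      using homog_in_carrier by auto
    then show ?thesis
      using 1 f_mult[OF 1(2-5)] f_closed[of "x \<otimes>\<^bsub>M\<^esub> y"]
      by (simp add: e1_incl f_closed A'.diff_self)
  next
    case (2 g h k x a b)
    then have closed: "x \<in> carrier M" "a \<in> carrier (free_alg K G M)" "b \<in> carrier (free_alg K G M)"
      using homog_in_carrier F.homog_subset by auto
    \<comment> \<open>This is the first identity of the nucleus at \<open>f x\<close>. It applies
      because \<open>e1\<close> preserves degrees, so that \<open>e1 a\<close> and
      \<open>e1 b\<close> are homogeneous of degrees \<open>h\<close> and \<open>k\<close>.\<close>
    have "associator A (f x) (e1 a) (e1 b) =
        \<ominus>\<^bsub>A\<^esub> (\<chi> g h \<odot>\<^bsub>A\<^esub> associator A (e1 a) (f x) (e1 b))"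
      using f_nucleus[OF 2(2,5)] 2 e1.hom_homog[OF 2(3,6)] e1.hom_homog[OF 2(4,7)]
      unfolding nucleus_homog_def by blast
    then show ?thesis
      using 2 closed by (simp add: e1_incl f_closed A'.M.l_neg)
  next
    case (3 g h k x a b)
    then have closed: "x \<in> carrier M" "a \<in> carrier (free_alg K G M)" "b \<in> carrier (free_alg K G M)"
      using homog_in_carrier F.homog_subset by auto
    have "associator A (e1 a) (e1 b) (f x) =
        \<ominus>\<^bsub>A\<^esub> (\<chi> k g \<odot>\<^bsub>A\<^esub> associator A (e1 a) (f x) (e1 b))"
      using f_nucleus[OF 3(2,5)] 3 e1.hom_homog[OF 3(3,6)] e1.hom_homog[OF 3(4,7)]
      unfolding nucleus_homog_def by blast
    \<comment> \<open>The nucleus gives \<open>(a,b,x)\<close> in terms of \<open>(a,x,b)\<close>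
      with factor \<open>\<chi> k g\<close>, whereas the relation puts \<open>\<chi> g k\<close> on
      \<open>(a,b,x)\<close>. Multiplying by \<open>\<chi> g k\<close> produces a product of both
      factors, which is one by skew-symmetry.\<close>
    then have "\<chi> g k \<odot>\<^bsub>A\<^esub> associator A (e1 a) (e1 b) (f x) =
        \<ominus>\<^bsub>A\<^esub> ((\<chi> g k \<otimes>\<^bsub>K\<^esub> \<chi> k g) \<odot>\<^bsub>A\<^esub> associator A (e1 a) (f x) (e1 b))"
      using 3 closed by (simp add: A'.smult_r_minus A'.smult_assoc1 f_closed)
    then show ?thesis
      using 3 closed by (simp add: e1_incl f_closed bichar_skew A'.M.r_neg)
  qed
  then have "e1 p = \<zero>\<^bsub>A\<^esub>" if "p \<in> env_ideal K G \<chi> M" for p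
    using that e1.alg_idl_kernel[OF env_rels_closed] by (simp add: env_ideal_rels)
  from env.hom_factor[OF A'.pregraded_algebra_axioms e1 this]
  obtain e2 where e2: "e2 \<in> color_hom K G (env_alg K G \<chi> M) A"
    and e2_coset: "\<And>p. p \<in> carrier (free_alg K G M)
      \<Longrightarrow> e2 (env_ideal K G \<chi> M +>\<^bsub>free_alg K G M\<^esub> p) = e1 p"
    unfolding env_alg_def by blast
  have "e2 (env_incl K G \<chi> M x) = f x" if "x \<in> carrier M" for x
    using that by (simp add: env_incl_def e2_coset e1_incl)
  with e2 show ?thesis
    by (rule that)
qed

end

text \<open>HOL functions are total, so a morphism is determined only on the carrier; uniqueness as
  a function requires this extensional representative. Restriction keeps degrees since homogeneous
  elements lie in the carrier.\<close>

lemma (in pregraded_algebra) color_hom_restrict: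
  assumes "h \<in> color_hom K G A B"
  shows "restrict h (carrier A) \<in> color_hom K G A B"
  using homog_subset by (intro color_homI) (auto simp: color_homD[OF assms] subset_iff)

theorem theorem3p10:
  fixes K :: "('k, 'r) ring_scheme"
    and G :: "('g, 's) monoid_scheme"
    and \<chi> :: "'g \<Rightarrow> 'g \<Rightarrow> 'k"
    and M :: "('k, 'm, 'g) graded_algebra"
    and A :: "('k, 'a, 'g) graded_algebra"
    and f :: "'m \<Rightarrow> 'a"
  assumes "field K"
    and "\<forall>n::nat. n > 0 \<longrightarrow> [n] \<cdot>\<^bsub>K\<^esub> \<one>\<^bsub>K\<^esub> \<noteq> \<zero>\<^bsub>K\<^esub>"
    and "comm_group G"
    and "skew_bicharacter K G \<chi>"
    and "malcev_color_algebra K G \<chi> M"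
    and "color_algebra K G A"
    and "f \<in> color_hom K G M (color_nucleus_minus G \<chi> A)"
  shows "\<exists>!h. h \<in> color_hom K G (env_alg K G \<chi> M) A \<and>
              h \<in> extensional (carrier (env_alg K G \<chi> M)) \<and>
              (\<forall>x\<in>carrier M. h (env_incl K G \<chi> M x) = f x)"
proof -
  interpret malcev_color_algebra K G \<chi> M
    by (rule assms)
  have A: "pregraded_algebra K G A"
    using assms by (intro color_algebra.pregraded_algebra)
  obtain h where h: "h \<in> color_hom K G (env_alg K G \<chi> M) A"
    "\<And>x. x \<in> carrier M \<Longrightarrow> h (env_incl K G \<chi> M x) = f x"
    using env_hom_exists assms by blast
  show ?thesis
  proof (intro ex1I[of _ "restrict h (carrier (env_alg K G \<chi> M))"] conjI ballI)
    show "restrict h (carrier (env_alg K G \<chi> M)) \<in> color_hom K G (env_alg K G \<chi> M) A"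
      by (rule pregraded_algebra.color_hom_restrict[OF env_pregraded h(1)])
    show "restrict h (carrier (env_alg K G \<chi> M)) (env_incl K G \<chi> M x) = f x" if "x \<in> carrier M" for x
      using that by (simp add: h(2) env_incl_closed)
    fix k
    assume k: "k \<in> color_hom K G (env_alg K G \<chi> M) A \<and> k \<in> extensional (carrier (env_alg K G \<chi> M)) \<and>
      (\<forall>x\<in>carrier M. k (env_incl K G \<chi> M x) = f x)"
    show "k = restrict h (carrier (env_alg K G \<chi> M))"
      using k h env_hom_unique[OF A, of k h]
      by (intro extensionalityI[of _ "carrier (env_alg K G \<chi> M)"]) auto
  qed simp
qed

end
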